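(* The logic $\mathbf{IGN}$ is algebraizable, with equivalent algebraic semantics given by the variety $\mathcal{HGN}$ of tense H-algebras and the structural transformers $\tau(\varphi)=\{\varphi\approx 1\}$ and $\rho(\varphi\approx\psi)=\{\varphi\to\psi,\ \psi\to\varphi\}$. That is, for every set $\Gamma\cup\{\varphi,\psi\}$ of $\mathcal L$-formulas: (1) $\Gamma\vdash_{\mathbf{IGN}}\varphi$ if and only if $\{\gamma\approx 1:\gamma\in\Gamma\}\vDash_{\mathcal{HGN}}\varphi\approx 1$; (2) $\varphi\approx\psi$ and $\tau(\rho(\varphi\approx\psi))=\{\varphi\to\psi\approx 1,\ \psi\to\varphi\approx 1\}$ are interderivable with respect to $\vDash_{\mathcal{HGN}}$ (each entails the other).
   Context: Tense H-algebra: a Heyting algebra $\langle A,\wedge,\vee,\to,0,1\rangle$ with unary operations $g,h,f,p$ such that for all $x,y\in A$: $g(1)=h(1)=0$; $f(0)=p(0)=1$; $g(x\wedge y)=g(x)\vee g(y)$, $h(x\wedge y)=h(x)\vee h(y)$; $f(x\vee y)=f(x)\wedge f(y)$, $p(x\vee y)=p(x)\wedge p(y)$; $gh(x)\le x$, $hg(x)\le x$; $x\le pf(x)$, $x\le fp(x)$; $g(x)\wedge f(y)\le g(x\vee y)$, $h(x)\wedge p(y)\le h(x\vee y)$; $f(x\wedge y)\le f(x)\vee g(y)$, $p(x\wedge y)\le p(x)\vee h(y)$. $\mathcal{HGN}$ is the variety of all tense H-algebras. Language: $\mathcal L=\{\vee,\wedge,\to,f,g,h,p,\top,\bot\}$ with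 $f,g,h,p$ unary; formulas are built from a countable set of propositional variables; $\top,\bot$ are interpreted as $1,0$ in algebras. The logic $\mathbf{IGN}$ (Intuitionistic Propositional Logic with Galois Negations) is given by the following Hilbert calculus. Axioms: all instances (in the language $\mathcal L$) of intuitionistic propositional logic, and all formulas $g\varphi\wedge f\psi\to g(\varphi\vee\psi)$; $f(\varphi\wedge\psi)\to f\varphi\vee g\psi$; $h\varphi\wedge p\psi\to h(\varphi\vee\psi)$; $p(\varphi\wedge\psi)\to p\varphi\vee h\psi$. Rules: from $\varphi\to\psi$ and $\varphi$ infer $\psi$; from $\varphi\to f\psi$ infer $\psi\to p\varphi$; from $g\varphi\to\psi$ infer $h\psi\to\varphi$. $\Gamma\vdash_{\mathbf{IGN}}\varphi$ means that $\varphi$ is derivable from $\Gamma$ in this calculus. For a set $\Theta\cup\{\epsilon\approx\delta\}$ of equations, $\Theta\vDash_{\mathcal K}\epsilon\approx\delta$ means: for every $\mathbf A\in\mathcal K$ and every assignment $m$ of the variables in $\mathbf A$, if $m(\alpha)=m(\beta)$ for all $\alpha\approx\beta\in\Theta$, then $m(\epsilon)=m(\delta)$. A set of equations is entailed when each of its members is.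
   Formalization: The two Galois rules are taken as invertible: also from ψ→pφ infer φ→fψ, and from hψ→φ infer gφ→ψ. With one-way rules (1) fails: on the two-element Heyting algebra with f=g=h=0, p=1 all axioms and rules hold, but f⊥ is 0, while f(0)=1 in HGN. *)

theory Defs
  imports Main "HOL-Library.Countable"
begin

subsection \<open>Heyting algebras and tense H-algebras\<close>

text \<open>Algebras have an explicit carrier set, so that a class of algebras is a set of records and
  can be quantified over inside a formula.\<close>

record 'a tense_alg =
  carrier :: "'a set"
  meet :: "'a \<Rightarrow> 'a \<Rightarrow> 'a" (infixl \<open>\<sqinter>\<index>\<close> 70)
  join :: "'a \<Rightarrow> 'a \<Rightarrow> 'a" (infixl \<open>\<squnion>\<index>\<close> 65)
  impl :: "'a \<Rightarrow> 'a \<Rightarrow> 'a" (infixr \<open>\<rightarrow>\<index>\<close> 60)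
  zero :: 'a (\<open>\<zero>\<index>\<close>)
  one  :: 'a (\<open>\<one>\<index>\<close>)
  gop :: "'a \<Rightarrow> 'a" (\<open>\<g>\<index>\<close>)
  hop :: "'a \<Rightarrow> 'a" (\<open>\<h>\<index>\<close>)
  fop :: "'a \<Rightarrow> 'a" (\<open>\<f>\<index>\<close>)
  pop :: "'a \<Rightarrow> 'a" (\<open>\<p>\<index>\<close>)

definition le :: "('a, 'b) tense_alg_scheme \<Rightarrow> 'a \<Rightarrow> 'a \<Rightarrow> bool" (infix \<open>\<sqsubseteq>\<index>\<close> 50) where
  "x \<sqsubseteq>\<^bsub>A\<^esub> y \<longleftrightarrow> x \<sqinter>\<^bsub>A\<^esub> y = x"

locale heyting_algebra =
  fixes A (structure)
  assumes meet_closed: "\<lbrakk>x \<in> carrier A; y \<in> carrier A\<rbrakk> \<Longrightarrow> x \<sqinter> y \<in> carrier A"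
    and join_closed: "\<lbrakk>x \<in> carrier A; y \<in> carrier A\<rbrakk> \<Longrightarrow> x \<squnion> y \<in> carrier A"
    and impl_closed: "\<lbrakk>x \<in> carrier A; y \<in> carrier A\<rbrakk> \<Longrightarrow> x \<rightarrow> y \<in> carrier A"
    and zero_closed: "\<zero> \<in> carrier A"
    and one_closed: "\<one> \<in> carrier A"
    and meet_assoc:
      "\<lbrakk>x \<in> carrier A; y \<in> carrier A; z \<in> carrier A\<rbrakk> \<Longrightarrow> (x \<sqinter> y) \<sqinter> z = x \<sqinter> (y \<sqinter> z)"
    and join_assoc:
      "\<lbrakk>x \<in> carrier A; y \<in> carrier A; z \<in> carrier A\<rbrakk> \<Longrightarrow> (x \<squnion> y) \<squnion> z = x \<squnion> (y \<squnion> z)"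
    and meet_comm: "\<lbrakk>x \<in> carrier A; y \<in> carrier A\<rbrakk> \<Longrightarrow> x \<sqinter> y = y \<sqinter> x"
    and join_comm: "\<lbrakk>x \<in> carrier A; y \<in> carrier A\<rbrakk> \<Longrightarrow> x \<squnion> y = y \<squnion> x"
    and meet_absorb: "\<lbrakk>x \<in> carrier A; y \<in> carrier A\<rbrakk> \<Longrightarrow> x \<sqinter> (x \<squnion> y) = x"
    and join_absorb: "\<lbrakk>x \<in> carrier A; y \<in> carrier A\<rbrakk> \<Longrightarrow> x \<squnion> (x \<sqinter> y) = x"
    and zero_least: "x \<in> carrier A \<Longrightarrow> \<zero> \<sqsubseteq> x"
    and one_greatest: "x \<in> carrier A \<Longrightarrow> x \<sqsubseteq> \<one>"
    and residuation:
      "\<lbrakk>x \<in> carrier A; y \<in> carrier A; z \<in> carrier A\<rbrakk> \<Longrightarrow> x \<sqinter> y \<sqsubseteq> z \<longleftrightarrow> x \<sqsubseteq> y \<rightarrow> z"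

locale tense_H_algebra = heyting_algebra +
  assumes g_closed: "x \<in> carrier A \<Longrightarrow> \<g> x \<in> carrier A"
    and h_closed: "x \<in> carrier A \<Longrightarrow> \<h> x \<in> carrier A"
    and f_closed: "x \<in> carrier A \<Longrightarrow> \<f> x \<in> carrier A"
    and p_closed: "x \<in> carrier A \<Longrightarrow> \<p> x \<in> carrier A"
    and g_one: "\<g> \<one> = \<zero>"
    and h_one: "\<h> \<one> = \<zero>"
    and f_zero: "\<f> \<zero> = \<one>"
    and p_zero: "\<p> \<zero> = \<one>"
    and g_meet: "\<lbrakk>x \<in> carrier A; y \<in> carrier A\<rbrakk> \<Longrightarrow> \<g> (x \<sqinter> y) = \<g> x \<squnion> \<g> y"
    and h_meet: "\<lbrakk>x \<in> carrier A; y \<in> carrier A\<rbrakk> \<Longrightarrow> \<h> (x \<sqinter> y) = \<h> x \<squnion> \<h> y"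
    and f_join: "\<lbrakk>x \<in> carrier A; y \<in> carrier A\<rbrakk> \<Longrightarrow> \<f> (x \<squnion> y) = \<f> x \<sqinter> \<f> y"
    and p_join: "\<lbrakk>x \<in> carrier A; y \<in> carrier A\<rbrakk> \<Longrightarrow> \<p> (x \<squnion> y) = \<p> x \<sqinter> \<p> y"
    and gh_le: "x \<in> carrier A \<Longrightarrow> \<g> (\<h> x) \<sqsubseteq> x"
    and hg_le: "x \<in> carrier A \<Longrightarrow> \<h> (\<g> x) \<sqsubseteq> x"
    and le_pf: "x \<in> carrier A \<Longrightarrow> x \<sqsubseteq> \<p> (\<f> x)"
    and le_fp: "x \<in> carrier A \<Longrightarrow> x \<sqsubseteq> \<f> (\<p> x)"
    and g_f_join: "\<lbrakk>x \<in> carrier A; y \<in> carrier A\<rbrakk> \<Longrightarrow> \<g> x \<sqinter> \<f> y \<sqsubseteq> \<g> (x \<squnion> y)"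
    and h_p_join: "\<lbrakk>x \<in> carrier A; y \<in> carrier A\<rbrakk> \<Longrightarrow> \<h> x \<sqinter> \<p> y \<sqsubseteq> \<h> (x \<squnion> y)"
    and f_g_meet: "\<lbrakk>x \<in> carrier A; y \<in> carrier A\<rbrakk> \<Longrightarrow> \<f> (x \<sqinter> y) \<sqsubseteq> \<f> x \<squnion> \<g> y"
    and p_h_meet: "\<lbrakk>x \<in> carrier A; y \<in> carrier A\<rbrakk> \<Longrightarrow> \<p> (x \<sqinter> y) \<sqsubseteq> \<p> x \<squnion> \<h> y"

text \<open>HOL has no class of all algebras across types: HGN at type \<open>'a\<close> consists of the tense H-algebras
  whose carrier is any subset of \<open>'a\<close>. If \<open>'a\<close> is infinite, this includes an isomorphic copy of
  every countable algebra, in particular of every Lindenbaum-Tarski algebra over countably many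
  variables.\<close>

definition HGN :: "'a tense_alg set" where
  "HGN = {A. tense_H_algebra A}"


subsection \<open>Formulas and the logic IGN\<close>

datatype 'v fm =
    Var 'v
  | Bot (\<open>\<^bold>\<bottom>\<close>)
  | Top (\<open>\<^bold>\<top>\<close>)
  | And "'v fm" "'v fm" (infixr \<open>\<^bold>\<and>\<close> 70)
  | Or "'v fm" "'v fm" (infixr \<open>\<^bold>\<or>\<close> 65)
  | Imp "'v fm" "'v fm" (infixr \<open>\<^bold>\<rightarrow>\<close> 60)
  | NegG "'v fm"
  | NegH "'v fm"
  | NegF "'v fm"
  | NegP "'v fm"

text \<open>The usual Hilbert-style axiom schemes of intuitionistic propositional logic, with
  instances taken in the full language. Negation is not primitive.\<close>

inductive_set ipl_axioms :: "'v fm set" where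
  K: "\<phi> \<^bold>\<rightarrow> \<psi> \<^bold>\<rightarrow> \<phi> \<in> ipl_axioms"
| S: "(\<phi> \<^bold>\<rightarrow> \<psi> \<^bold>\<rightarrow> \<chi>) \<^bold>\<rightarrow> (\<phi> \<^bold>\<rightarrow> \<psi>) \<^bold>\<rightarrow> \<phi> \<^bold>\<rightarrow> \<chi> \<in> ipl_axioms"
| AndE1: "\<phi> \<^bold>\<and> \<psi> \<^bold>\<rightarrow> \<phi> \<in> ipl_axioms"
| AndE2: "\<phi> \<^bold>\<and> \<psi> \<^bold>\<rightarrow> \<psi> \<in> ipl_axioms"
| AndI: "\<phi> \<^bold>\<rightarrow> \<psi> \<^bold>\<rightarrow> \<phi> \<^bold>\<and> \<psi> \<in> ipl_axioms"
| OrI1: "\<phi> \<^bold>\<rightarrow> \<phi> \<^bold>\<or> \<psi> \<in> ipl_axioms"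
| OrI2: "\<psi> \<^bold>\<rightarrow> \<phi> \<^bold>\<or> \<psi> \<in> ipl_axioms"
| OrE: "(\<phi> \<^bold>\<rightarrow> \<chi>) \<^bold>\<rightarrow> (\<psi> \<^bold>\<rightarrow> \<chi>) \<^bold>\<rightarrow> \<phi> \<^bold>\<or> \<psi> \<^bold>\<rightarrow> \<chi> \<in> ipl_axioms"
| BotE: "\<^bold>\<bottom> \<^bold>\<rightarrow> \<phi> \<in> ipl_axioms"
| TopI: "\<^bold>\<top> \<in> ipl_axioms"

inductive_set galois_axioms :: "'v fm set" where
  GF: "NegG \<phi> \<^bold>\<and> NegF \<psi> \<^bold>\<rightarrow> NegG (\<phi> \<^bold>\<or> \<psi>) \<in> galois_axioms"
| FG: "NegF (\<phi> \<^bold>\<and> \<psi>) \<^bold>\<rightarrow> NegF \<phi> \<^bold>\<or> NegG \<psi> \<in> galois_axioms"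
| HP: "NegH \<phi> \<^bold>\<and> NegP \<psi> \<^bold>\<rightarrow> NegH (\<phi> \<^bold>\<or> \<psi>) \<in> galois_axioms"
| PH: "NegP (\<phi> \<^bold>\<and> \<psi>) \<^bold>\<rightarrow> NegP \<phi> \<^bold>\<or> NegH \<psi> \<in> galois_axioms"

text \<open>The rules are global: they apply to any formulas derived from the set of premises, not only
  to theorems. The Galois rules are invertible, so that \<open>NegF\<close>, \<open>NegP\<close> and \<open>NegG\<close>, \<open>NegH\<close> form
  Galois pairs. The downward directions alone are not complete for HGN: all axioms and those rules
  are valid in the two-element Heyting algebra with f, g, h constantly 0 and p constantly 1, where
  \<open>NegF \<^bold>\<bottom>\<close> takes the value 0.\<close>

inductive IGN :: "'v fm set \<Rightarrow> 'v fm \<Rightarrow> bool" (infix \<open>\<turnstile>\<close> 45) for \<Gamma> :: "'v fm set" where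
  premise: "\<phi> \<in> \<Gamma> \<Longrightarrow> \<Gamma> \<turnstile> \<phi>"
| ipl: "\<phi> \<in> ipl_axioms \<Longrightarrow> \<Gamma> \<turnstile> \<phi>"
| galois: "\<phi> \<in> galois_axioms \<Longrightarrow> \<Gamma> \<turnstile> \<phi>"
| MP: "\<lbrakk>\<Gamma> \<turnstile> \<phi> \<^bold>\<rightarrow> \<psi>; \<Gamma> \<turnstile> \<phi>\<rbrakk> \<Longrightarrow> \<Gamma> \<turnstile> \<psi>"
| FP_down: "\<Gamma> \<turnstile> \<phi> \<^bold>\<rightarrow> NegF \<psi> \<Longrightarrow> \<Gamma> \<turnstile> \<psi> \<^bold>\<rightarrow> NegP \<phi>"
| FP_up: "\<Gamma> \<turnstile> \<psi> \<^bold>\<rightarrow> NegP \<phi> \<Longrightarrow> \<Gamma> \<turnstile> \<phi> \<^bold>\<rightarrow> NegF \<psi>"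
| GH_down: "\<Gamma> \<turnstile> NegG \<phi> \<^bold>\<rightarrow> \<psi> \<Longrightarrow> \<Gamma> \<turnstile> NegH \<psi> \<^bold>\<rightarrow> \<phi>"
| GH_up: "\<Gamma> \<turnstile> NegH \<psi> \<^bold>\<rightarrow> \<phi> \<Longrightarrow> \<Gamma> \<turnstile> NegG \<phi> \<^bold>\<rightarrow> \<psi>"


subsection \<open>Equational consequence and the transformers\<close>

datatype 'v eqn = Eqn (lhs: "'v fm") (rhs: "'v fm") (infix \<open>\<^bold>\<approx>\<close> 50)

primrec eval :: "('a, 'b) tense_alg_scheme \<Rightarrow> ('v \<Rightarrow> 'a) \<Rightarrow> 'v fm \<Rightarrow> 'a" where
  "eval A m (Var v) = m v"
| "eval A m \<^bold>\<bottom> = \<zero>\<^bsub>A\<^esub>"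
| "eval A m \<^bold>\<top> = \<one>\<^bsub>A\<^esub>"
| "eval A m (\<phi> \<^bold>\<and> \<psi>) = eval A m \<phi> \<sqinter>\<^bsub>A\<^esub> eval A m \<psi>"
| "eval A m (\<phi> \<^bold>\<or> \<psi>) = eval A m \<phi> \<squnion>\<^bsub>A\<^esub> eval A m \<psi>"
| "eval A m (\<phi> \<^bold>\<rightarrow> \<psi>) = eval A m \<phi> \<rightarrow>\<^bsub>A\<^esub> eval A m \<psi>"
| "eval A m (NegG \<phi>) = \<g>\<^bsub>A\<^esub> (eval A m \<phi>)"
| "eval A m (NegH \<phi>) = \<h>\<^bsub>A\<^esub> (eval A m \<phi>)"
| "eval A m (NegF \<phi>) = \<f>\<^bsub>A\<^esub> (eval A m \<phi>)"
| "eval A m (NegP \<phi>) = \<p>\<^bsub>A\<^esub> (eval A m \<phi>)"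

definition sat :: "('a, 'b) tense_alg_scheme \<Rightarrow> ('v \<Rightarrow> 'a) \<Rightarrow> 'v eqn \<Rightarrow> bool" where
  "sat A m e \<longleftrightarrow> eval A m (lhs e) = eval A m (rhs e)"

definition entails :: "'a tense_alg set \<Rightarrow> 'v eqn set \<Rightarrow> 'v eqn \<Rightarrow> bool" where
  "entails K \<Theta> e \<longleftrightarrow>
    (\<forall>A\<in>K. \<forall>m. (\<forall>v. m v \<in> carrier A) \<longrightarrow> (\<forall>d\<in>\<Theta>. sat A m d) \<longrightarrow> sat A m e)"

definition entails_all :: "'a tense_alg set \<Rightarrow> 'v eqn set \<Rightarrow> 'v eqn set \<Rightarrow> bool" where
  "entails_all K \<Theta> \<Delta> \<longleftrightarrow> (\<forall>e\<in>\<Delta>. entails K \<Theta> e)"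

definition tau :: "'v fm \<Rightarrow> 'v eqn set" where
  "tau \<phi> = {\<phi> \<^bold>\<approx> \<^bold>\<top>}"

definition rho :: "'v eqn \<Rightarrow> 'v fm set" where
  "rho e = {lhs e \<^bold>\<rightarrow> rhs e, rhs e \<^bold>\<rightarrow> lhs e}"

definition tau_set :: "'v fm set \<Rightarrow> 'v eqn set" where
  "tau_set \<Gamma> = (\<Union>\<gamma>\<in>\<Gamma>. tau \<gamma>)"

end

theory Submission
  imports Defs
begin

text \<open>Soundness is an induction on derivations. For completeness, the formulas modulo provable
  equivalence from \<open>\<Gamma>\<close> form a tense H-algebra in which the class of \<open>\<phi>\<close> is the unit exactly when
  \<open>\<Gamma> \<turnstile> \<phi>\<close>. The Galois rules make the negations antitone, which gives well-defined operations and
  all identities that are not axioms. Since there are only countably many formulas, this algebra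
  can be realised on a subset of any infinite type.\<close>

section \<open>Soundness\<close>

context heyting_algebra
begin

text \<open>Two absorptions: \<open>x = x \<squnion> (x \<sqinter> x)\<close>, and meeting
  \<open>x\<close> with the right-hand side gives \<open>x\<close> again.\<close>

lemma meet_idem: "x \<in> carrier A \<Longrightarrow> x \<sqinter> x = x"
  by (metis join_absorb meet_absorb meet_closed)

lemma le_refl: "x \<in> carrier A \<Longrightarrow> x \<sqsubseteq> x"
  by (simp add: le_def meet_idem)

lemma le_antisym: "\<lbrakk>x \<in> carrier A; y \<in> carrier A; x \<sqsubseteq> y; y \<sqsubseteq> x\<rbrakk> \<Longrightarrow> x = y"
  by (metis le_def meet_comm)

lemma le_trans:
  "\<lbrakk>x \<in> carrier A; y \<in> carrier A; z \<in> carrier A; x \<sqsubseteq> y; y \<sqsubseteq> z\<rbrakk> \<Longrightarrow> x \<sqsubseteq> z"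
  by (metis le_def meet_assoc)

lemma le_iff_join: "\<lbrakk>x \<in> carrier A; y \<in> carrier A\<rbrakk> \<Longrightarrow> x \<sqsubseteq> y \<longleftrightarrow> x \<squnion> y = y"
  by (metis le_def join_absorb join_comm meet_absorb meet_comm)

lemma meet_le1: "\<lbrakk>x \<in> carrier A; y \<in> carrier A\<rbrakk> \<Longrightarrow> x \<sqinter> y \<sqsubseteq> x"
  by (metis le_def meet_assoc meet_comm meet_idem)

lemma meet_le2: "\<lbrakk>x \<in> carrier A; y \<in> carrier A\<rbrakk> \<Longrightarrow> x \<sqinter> y \<sqsubseteq> y"
  by (metis meet_comm meet_le1)

lemma meet_leI1: "\<lbrakk>x \<in> carrier A; y \<in> carrier A; z \<in> carrier A; x \<sqsubseteq> z\<rbrakk> \<Longrightarrow> x \<sqinter> y \<sqsubseteq> z"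
  by (blast intro: le_trans meet_closed meet_le1)

lemma le_join1: "\<lbrakk>x \<in> carrier A; y \<in> carrier A\<rbrakk> \<Longrightarrow> x \<sqsubseteq> x \<squnion> y"
  by (simp add: le_def meet_absorb)

lemma le_join2: "\<lbrakk>x \<in> carrier A; y \<in> carrier A\<rbrakk> \<Longrightarrow> y \<sqsubseteq> x \<squnion> y"
  by (metis join_comm le_join1)

lemma join_leI:
  "\<lbrakk>x \<in> carrier A; y \<in> carrier A; z \<in> carrier A; x \<sqsubseteq> z; y \<sqsubseteq> z\<rbrakk> \<Longrightarrow> x \<squnion> y \<sqsubseteq> z"
  by (metis join_assoc join_closed le_iff_join)

text \<open>Residuation against \<open>\<one>\<close>, the unit of meet. This is the bridge between
  equations with right-hand side \<open>\<one>\<close> and the order, for soundness as well as for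
  the transformers.\<close>

lemma impl_eq_one_iff:
  assumes "x \<in> carrier A" "y \<in> carrier A"
  shows "x \<rightarrow> y = \<one> \<longleftrightarrow> x \<sqsubseteq> y"
proof -
  have "x \<rightarrow> y = \<one> \<longleftrightarrow> \<one> \<sqsubseteq> x \<rightarrow> y"
    using assms by (metis impl_closed le_antisym le_refl one_closed one_greatest)
  also have "\<dots> \<longleftrightarrow> \<one> \<sqinter> x \<sqsubseteq> y"
    using assms by (simp add: one_closed residuation)
  also have "\<one> \<sqinter> x = x"
    using assms by (metis le_def meet_comm one_closed one_greatest)
  finally show ?thesis .
qed

text \<open>By residuation both inequalities bound the meet of \<open>x\<close> and \<open>y\<close>
  by \<open>z\<close>, and meet is commutative.\<close>

lemma impl_swap:
  assumes "x \<in> carrier A" "y \<in> carrier A" "z \<in> carrier A" "x \<sqsubseteq> y \<rightarrow> z"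
  shows "y \<sqsubseteq> x \<rightarrow> z"
  using assms by (metis meet_comm residuation)

lemma mp_le:
  assumes "z \<sqsubseteq> x \<rightarrow> y" "z \<sqsubseteq> x" "x \<in> carrier A" "y \<in> carrier A" "z \<in> carrier A"
  shows "z \<sqsubseteq> y"
  using assms by (metis le_def residuation)

end

section \<open>Validity of the calculus in tense H-algebras\<close>

context tense_H_algebra
begin

lemma eval_closed: "\<forall>v. m v \<in> carrier A \<Longrightarrow> eval A m \<phi> \<in> carrier A"
  by (induction \<phi>) (auto intro: meet_closed join_closed impl_closed zero_closed one_closed
      g_closed h_closed f_closed p_closed)

text \<open>If \<open>x = x \<sqinter> y\<close>, then \<open>g_meet\<close> writes
  \<open>\<g> x\<close> as a join with \<open>\<g> y\<close>. For \<open>f\<close> and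
  \<open>p\<close> the order is read through joins instead.\<close>

lemma g_antimono: "\<lbrakk>x \<in> carrier A; y \<in> carrier A; x \<sqsubseteq> y\<rbrakk> \<Longrightarrow> \<g> y \<sqsubseteq> \<g> x"
  by (metis le_def g_meet g_closed le_join2)

lemma h_antimono: "\<lbrakk>x \<in> carrier A; y \<in> carrier A; x \<sqsubseteq> y\<rbrakk> \<Longrightarrow> \<h> y \<sqsubseteq> \<h> x"
  by (metis le_def h_meet h_closed le_join2)

lemma f_antimono: "\<lbrakk>x \<in> carrier A; y \<in> carrier A; x \<sqsubseteq> y\<rbrakk> \<Longrightarrow> \<f> y \<sqsubseteq> \<f> x"
  by (metis le_iff_join f_join f_closed meet_le1)

lemma p_antimono: "\<lbrakk>x \<in> carrier A; y \<in> carrier A; x \<sqsubseteq> y\<rbrakk> \<Longrightarrow> \<p> y \<sqsubseteq> \<p> x"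
  by (metis le_iff_join p_join p_closed meet_le1)

text \<open>From \<open>x \<sqsubseteq> \<f> y\<close> one gets
  \<open>y \<sqsubseteq> \<p> (\<f> y) \<sqsubseteq> \<p> x\<close>, and symmetrically. This is the
  semantic content of \<open>FP_down\<close> and \<open>FP_up\<close>.\<close>

lemma f_p_galois:
  assumes "x \<in> carrier A" "y \<in> carrier A"
  shows "x \<sqsubseteq> \<f> y \<longleftrightarrow> y \<sqsubseteq> \<p> x"
  using assms by (meson f_antimono f_closed le_fp le_pf le_trans p_antimono p_closed)

text \<open>The order dual: from \<open>\<g> x \<sqsubseteq> y\<close> one gets
  \<open>\<h> y \<sqsubseteq> \<h> (\<g> x) \<sqsubseteq> x\<close>.\<close>

lemma g_h_galois:
  assumes "x \<in> carrier A" "y \<in> carrier A"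
  shows "\<g> x \<sqsubseteq> y \<longleftrightarrow> \<h> y \<sqsubseteq> x"
  using assms by (meson g_antimono g_closed gh_le h_antimono h_closed hg_le le_trans)

lemma ipl_axioms_sound:
  assumes "\<phi> \<in> ipl_axioms" and m: "\<forall>v. m v \<in> carrier A"
  shows "eval A m \<phi> = \<one>"
proof -
  note cl = eval_closed[OF m] impl_closed meet_closed join_closed zero_closed one_closed
  show ?thesis
    using assms(1)
  proof cases
    case (S \<alpha> \<beta> \<gamma>)
    let ?a = "eval A m \<alpha>" and ?b = "eval A m \<beta>" and ?c = "eval A m \<gamma>"
    \<comment> \<open>The meet of all antecedents of the axiom; once it lies below
      \<open>?c\<close>, residuation restores the nested implications.\<close>
    let ?l = "((?a \<rightarrow> ?b \<rightarrow> ?c) \<sqinter> (?a \<rightarrow> ?b)) \<sqinter> ?a"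
    have a: "?l \<sqsubseteq> ?a"
      by (simp add: cl meet_le2)
    have "?l \<sqsubseteq> ?a \<rightarrow> ?b" "?l \<sqsubseteq> ?a \<rightarrow> ?b \<rightarrow> ?c"
      by (simp_all add: cl meet_leI1 meet_le1 meet_le2)
    then have "?l \<sqsubseteq> ?b \<rightarrow> ?c" "?l \<sqsubseteq> ?b"
      using a by (auto intro: mp_le simp: cl)
    then have "?l \<sqsubseteq> ?c"
      by (rule mp_le) (simp_all add: cl)
    then show ?thesis
      by (simp add: S impl_eq_one_iff cl flip: residuation)
  next
    case (OrE \<alpha> \<gamma> \<beta>)
    let ?a = "eval A m \<alpha>" and ?b = "eval A m \<beta>" and ?c = "eval A m \<gamma>"
    let ?l = "(?a \<rightarrow> ?c) \<sqinter> (?b \<rightarrow> ?c)"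
    have "?l \<sqsubseteq> ?a \<rightarrow> ?c" "?l \<sqsubseteq> ?b \<rightarrow> ?c"
      by (simp_all add: cl meet_le1 meet_le2)
    \<comment> \<open>Swapping puts \<open>?a\<close> and \<open>?b\<close> on the left, where their
      join can be formed; a second swap returns to the required shape.\<close>
    then have "?a \<sqsubseteq> ?l \<rightarrow> ?c" "?b \<sqsubseteq> ?l \<rightarrow> ?c"
      by (simp_all add: cl impl_swap)
    then have "?a \<squnion> ?b \<sqsubseteq> ?l \<rightarrow> ?c"
      by (simp add: cl join_leI)
    then have "?l \<sqsubseteq> ?a \<squnion> ?b \<rightarrow> ?c"
      by (simp add: cl impl_swap)
    then show ?thesis
      by (simp add: OrE impl_eq_one_iff cl flip: residuation)
  qed (simp_all add: impl_eq_one_iff cl meet_le1 meet_le2 le_join1 le_join2 zero_least le_refl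
      flip: residuation)
qed

lemma galois_axioms_sound:
  assumes "\<phi> \<in> galois_axioms" and m: "\<forall>v. m v \<in> carrier A"
  shows "eval A m \<phi> = \<one>"
  using assms(1)
  by cases (simp_all add: impl_eq_one_iff eval_closed[OF m] meet_closed join_closed
      g_closed h_closed f_closed p_closed g_f_join h_p_join f_g_meet p_h_meet)

text \<open>One fixed assignment suffices for the global rules: an implication has value
  \<open>\<one>\<close> exactly when an inequality holds, and the two Galois connections transfer
  that inequality from premise to conclusion.\<close>

lemma IGN_sound:
  assumes "\<Gamma> \<turnstile> \<phi>" and m: "\<forall>v. m v \<in> carrier A"
    and "\<forall>\<gamma>\<in>\<Gamma>. eval A m \<gamma> = \<one>"
  shows "eval A m \<phi> = \<one>"
  using assms(1)
proof induction
  case (MP \<phi> \<psi>)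
  then have "\<one> \<sqsubseteq> eval A m \<psi>"
    using impl_eq_one_iff eval_closed[OF m] by (metis eval.simps(6))
  then show ?case
    by (metis eval_closed[OF m] le_antisym one_closed one_greatest)
qed (use assms(3) in \<open>simp_all add: ipl_axioms_sound[OF _ m] galois_axioms_sound[OF _ m]
    impl_eq_one_iff eval_closed[OF m] g_closed h_closed f_closed p_closed f_p_galois g_h_galois\<close>)

end

section \<open>Derived rules\<close>

lemma imp_K: "\<Gamma> \<turnstile> \<psi> \<Longrightarrow> \<Gamma> \<turnstile> \<phi> \<^bold>\<rightarrow> \<psi>"
  by (meson IGN.MP IGN.ipl ipl_axioms.K)

lemma imp_S: "\<lbrakk>\<Gamma> \<turnstile> \<phi> \<^bold>\<rightarrow> \<psi> \<^bold>\<rightarrow> \<chi>; \<Gamma> \<turnstile> \<phi> \<^bold>\<rightarrow> \<psi>\<rbrakk> \<Longrightarrow> \<Gamma> \<turnstile> \<phi> \<^bold>\<rightarrow> \<chi>"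
  by (meson IGN.MP IGN.ipl ipl_axioms.S)

lemma imp_refl: "\<Gamma> \<turnstile> \<phi> \<^bold>\<rightarrow> \<phi>"
  by (meson IGN.ipl imp_S ipl_axioms.K)

lemma imp_trans: "\<lbrakk>\<Gamma> \<turnstile> \<phi> \<^bold>\<rightarrow> \<psi>; \<Gamma> \<turnstile> \<psi> \<^bold>\<rightarrow> \<chi>\<rbrakk> \<Longrightarrow> \<Gamma> \<turnstile> \<phi> \<^bold>\<rightarrow> \<chi>"
  by (meson imp_K imp_S)

lemma and_imp1: "\<Gamma> \<turnstile> \<phi> \<^bold>\<rightarrow> \<chi> \<Longrightarrow> \<Gamma> \<turnstile> \<phi> \<^bold>\<and> \<psi> \<^bold>\<rightarrow> \<chi>"
  by (meson IGN.ipl imp_trans ipl_axioms.AndE1)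

lemma and_imp2: "\<Gamma> \<turnstile> \<psi> \<^bold>\<rightarrow> \<chi> \<Longrightarrow> \<Gamma> \<turnstile> \<phi> \<^bold>\<and> \<psi> \<^bold>\<rightarrow> \<chi>"
  by (meson IGN.ipl imp_trans ipl_axioms.AndE2)

lemma imp_and: "\<lbrakk>\<Gamma> \<turnstile> \<chi> \<^bold>\<rightarrow> \<phi>; \<Gamma> \<turnstile> \<chi> \<^bold>\<rightarrow> \<psi>\<rbrakk> \<Longrightarrow> \<Gamma> \<turnstile> \<chi> \<^bold>\<rightarrow> \<phi> \<^bold>\<and> \<psi>"
  by (meson IGN.ipl imp_K imp_S ipl_axioms.AndI)

lemma imp_or1: "\<Gamma> \<turnstile> \<chi> \<^bold>\<rightarrow> \<phi> \<Longrightarrow> \<Gamma> \<turnstile> \<chi> \<^bold>\<rightarrow> \<phi> \<^bold>\<or> \<psi>"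
  by (meson IGN.ipl imp_trans ipl_axioms.OrI1)

lemma imp_or2: "\<Gamma> \<turnstile> \<chi> \<^bold>\<rightarrow> \<psi> \<Longrightarrow> \<Gamma> \<turnstile> \<chi> \<^bold>\<rightarrow> \<phi> \<^bold>\<or> \<psi>"
  by (meson IGN.ipl imp_trans ipl_axioms.OrI2)

lemma or_imp: "\<lbrakk>\<Gamma> \<turnstile> \<phi> \<^bold>\<rightarrow> \<chi>; \<Gamma> \<turnstile> \<psi> \<^bold>\<rightarrow> \<chi>\<rbrakk> \<Longrightarrow> \<Gamma> \<turnstile> \<phi> \<^bold>\<or> \<psi> \<^bold>\<rightarrow> \<chi>"
  by (meson IGN.MP IGN.ipl ipl_axioms.OrE)

lemma bot_imp: "\<Gamma> \<turnstile> \<^bold>\<bottom> \<^bold>\<rightarrow> \<phi>"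
  by (simp add: IGN.ipl ipl_axioms.BotE)

lemma imp_top: "\<Gamma> \<turnstile> \<phi> \<^bold>\<rightarrow> \<^bold>\<top>"
  by (simp add: IGN.ipl imp_K ipl_axioms.TopI)

lemmas lattice_rules = imp_refl and_imp1 and_imp2 imp_and imp_or1 imp_or2 or_imp

lemma imp_residuation: "\<Gamma> \<turnstile> \<phi> \<^bold>\<and> \<psi> \<^bold>\<rightarrow> \<chi> \<longleftrightarrow> \<Gamma> \<turnstile> \<phi> \<^bold>\<rightarrow> \<psi> \<^bold>\<rightarrow> \<chi>"
proof
  assume "\<Gamma> \<turnstile> \<phi> \<^bold>\<and> \<psi> \<^bold>\<rightarrow> \<chi>"
  \<comment> \<open>The premise is weakened by \<open>\<psi>\<close>, and \<open>S\<close>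
    distributes \<open>\<psi>\<close> over it; \<open>AndI\<close> then supplies the
    antecedent.\<close>
  then have "\<Gamma> \<turnstile> (\<psi> \<^bold>\<rightarrow> \<phi> \<^bold>\<and> \<psi>) \<^bold>\<rightarrow> \<psi> \<^bold>\<rightarrow> \<chi>"
    by (meson IGN.MP IGN.ipl imp_K ipl_axioms.S)
  then show "\<Gamma> \<turnstile> \<phi> \<^bold>\<rightarrow> \<psi> \<^bold>\<rightarrow> \<chi>"
    by (meson IGN.ipl imp_trans ipl_axioms.AndI)
next
  assume "\<Gamma> \<turnstile> \<phi> \<^bold>\<rightarrow> \<psi> \<^bold>\<rightarrow> \<chi>"
  then show "\<Gamma> \<turnstile> \<phi> \<^bold>\<and> \<psi> \<^bold>\<rightarrow> \<chi>"
    by (meson imp_S and_imp1 and_imp2 imp_refl)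
qed

text \<open>Modus ponens, internalised by residuation, after strengthening the antecedent. It makes
  implication well defined on classes.\<close>

lemma imp_mono:
  assumes "\<Gamma> \<turnstile> \<phi>' \<^bold>\<rightarrow> \<phi>" "\<Gamma> \<turnstile> \<psi> \<^bold>\<rightarrow> \<psi>'"
  shows "\<Gamma> \<turnstile> (\<phi> \<^bold>\<rightarrow> \<psi>) \<^bold>\<rightarrow> \<phi>' \<^bold>\<rightarrow> \<psi>'"
proof -
  have "\<Gamma> \<turnstile> (\<phi> \<^bold>\<rightarrow> \<psi>) \<^bold>\<and> \<phi> \<^bold>\<rightarrow> \<psi>'"
    using assms(2) by (meson imp_residuation imp_refl imp_trans)
  moreover have "\<Gamma> \<turnstile> (\<phi> \<^bold>\<rightarrow> \<psi>) \<^bold>\<and> \<phi>' \<^bold>\<rightarrow> (\<phi> \<^bold>\<rightarrow> \<psi>) \<^bold>\<and> \<phi>"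
    using assms(1) by (blast intro: lattice_rules)
  ultimately show ?thesis
    by (meson imp_residuation imp_trans)
qed

section \<open>The Galois pairs of negations inside the calculus\<close>

lemma gh_imp: "\<Gamma> \<turnstile> NegG (NegH \<phi>) \<^bold>\<rightarrow> \<phi>"
  by (simp add: IGN.GH_up imp_refl)

lemma hg_imp: "\<Gamma> \<turnstile> NegH (NegG \<phi>) \<^bold>\<rightarrow> \<phi>"
  by (simp add: IGN.GH_down imp_refl)

lemma imp_pf: "\<Gamma> \<turnstile> \<phi> \<^bold>\<rightarrow> NegP (NegF \<phi>)"
  by (simp add: IGN.FP_down imp_refl)

lemma imp_fp: "\<Gamma> \<turnstile> \<phi> \<^bold>\<rightarrow> NegF (NegP \<phi>)"
  by (simp add: IGN.FP_up imp_refl)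

text \<open>Chaining \<open>hg_imp\<close> with the premise derives \<open>\<psi>\<close> from
  \<open>NegH (NegG \<phi>)\<close>, and \<open>GH_up\<close> transposes this. The other three
  negations are handled alike.\<close>

lemma NegG_antimono: "\<Gamma> \<turnstile> \<phi> \<^bold>\<rightarrow> \<psi> \<Longrightarrow> \<Gamma> \<turnstile> NegG \<psi> \<^bold>\<rightarrow> NegG \<phi>"
  by (meson IGN.GH_up hg_imp imp_trans)

lemma NegH_antimono: "\<Gamma> \<turnstile> \<phi> \<^bold>\<rightarrow> \<psi> \<Longrightarrow> \<Gamma> \<turnstile> NegH \<psi> \<^bold>\<rightarrow> NegH \<phi>"
  by (meson IGN.GH_down gh_imp imp_trans)

lemma NegF_antimono: "\<Gamma> \<turnstile> \<phi> \<^bold>\<rightarrow> \<psi> \<Longrightarrow> \<Gamma> \<turnstile> NegF \<psi> \<^bold>\<rightarrow> NegF \<phi>"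
  by (meson IGN.FP_up imp_pf imp_trans)

lemma NegP_antimono: "\<Gamma> \<turnstile> \<phi> \<^bold>\<rightarrow> \<psi> \<Longrightarrow> \<Gamma> \<turnstile> NegP \<psi> \<^bold>\<rightarrow> NegP \<phi>"
  by (meson IGN.FP_down imp_fp imp_trans)

text \<open>Transposition moves the conjunction to the right of the arrow, where each conjunct is
  treated separately by antitonicity and \<open>hg_imp\<close>. The converse is mere
  antitonicity.\<close>

lemma NegG_and: "\<Gamma> \<turnstile> NegG (\<phi> \<^bold>\<and> \<psi>) \<^bold>\<rightarrow> NegG \<phi> \<^bold>\<or> NegG \<psi>"
proof (rule IGN.GH_up, rule imp_and)
  show "\<Gamma> \<turnstile> NegH (NegG \<phi> \<^bold>\<or> NegG \<psi>) \<^bold>\<rightarrow> \<phi>"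
    by (meson NegH_antimono hg_imp imp_trans imp_or1 imp_refl)
  show "\<Gamma> \<turnstile> NegH (NegG \<phi> \<^bold>\<or> NegG \<psi>) \<^bold>\<rightarrow> \<psi>"
    by (meson NegH_antimono hg_imp imp_trans imp_or2 imp_refl)
qed

lemma NegH_and: "\<Gamma> \<turnstile> NegH (\<phi> \<^bold>\<and> \<psi>) \<^bold>\<rightarrow> NegH \<phi> \<^bold>\<or> NegH \<psi>"
proof (rule IGN.GH_down, rule imp_and)
  show "\<Gamma> \<turnstile> NegG (NegH \<phi> \<^bold>\<or> NegH \<psi>) \<^bold>\<rightarrow> \<phi>"
    by (meson NegG_antimono gh_imp imp_trans imp_or1 imp_refl)
  show "\<Gamma> \<turnstile> NegG (NegH \<phi> \<^bold>\<or> NegH \<psi>) \<^bold>\<rightarrow> \<psi>"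
    by (meson NegG_antimono gh_imp imp_trans imp_or2 imp_refl)
qed

text \<open>Dually, transposition moves the disjunction to the left of the arrow, and each disjunct
  follows from \<open>imp_pf\<close> and antitonicity.\<close>

lemma NegF_or: "\<Gamma> \<turnstile> NegF \<phi> \<^bold>\<and> NegF \<psi> \<^bold>\<rightarrow> NegF (\<phi> \<^bold>\<or> \<psi>)"
proof (rule IGN.FP_up, rule or_imp)
  show "\<Gamma> \<turnstile> \<phi> \<^bold>\<rightarrow> NegP (NegF \<phi> \<^bold>\<and> NegF \<psi>)"
    by (meson NegP_antimono imp_pf imp_trans and_imp1 imp_refl)
  show "\<Gamma> \<turnstile> \<psi> \<^bold>\<rightarrow> NegP (NegF \<phi> \<^bold>\<and> NegF \<psi>)"
    by (meson NegP_antimono imp_pf imp_trans and_imp2 imp_refl)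
qed

lemma NegP_or: "\<Gamma> \<turnstile> NegP \<phi> \<^bold>\<and> NegP \<psi> \<^bold>\<rightarrow> NegP (\<phi> \<^bold>\<or> \<psi>)"
proof (rule IGN.FP_down, rule or_imp)
  show "\<Gamma> \<turnstile> \<phi> \<^bold>\<rightarrow> NegF (NegP \<phi> \<^bold>\<and> NegP \<psi>)"
    by (meson NegF_antimono imp_fp imp_trans and_imp1 imp_refl)
  show "\<Gamma> \<turnstile> \<psi> \<^bold>\<rightarrow> NegF (NegP \<phi> \<^bold>\<and> NegP \<psi>)"
    by (meson NegF_antimono imp_fp imp_trans and_imp2 imp_refl)
qed

section \<open>The Lindenbaum-Tarski algebra\<close>

text \<open>The map \<open>cls\<close> names the classes of provable equivalence by elements of \<open>'a\<close>; on its range,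
  \<open>inv cls\<close> picks a representative.\<close>

locale lindenbaum =
  fixes \<Gamma> :: "'v fm set" and cls :: "'v fm \<Rightarrow> 'a"
  assumes cls_eq_iff: "cls \<phi> = cls \<psi> \<longleftrightarrow> \<Gamma> \<turnstile> \<phi> \<^bold>\<rightarrow> \<psi> \<and> \<Gamma> \<turnstile> \<psi> \<^bold>\<rightarrow> \<phi>"
begin

definition LT :: "'a tense_alg" where
  "LT = \<lparr>carrier = range cls,
    meet = (\<lambda>a b. cls (inv cls a \<^bold>\<and> inv cls b)),
    join = (\<lambda>a b. cls (inv cls a \<^bold>\<or> inv cls b)),
    impl = (\<lambda>a b. cls (inv cls a \<^bold>\<rightarrow> inv cls b)),
    zero = cls \<^bold>\<bottom>, one = cls \<^bold>\<top>,
    gop = (\<lambda>a. cls (NegG (inv cls a))), hop = (\<lambda>a. cls (NegH (inv cls a))),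
    fop = (\<lambda>a. cls (NegF (inv cls a))), pop = (\<lambda>a. cls (NegP (inv cls a)))\<rparr>"

text \<open>\<open>cls \<phi>\<close> lies in the range of \<open>cls\<close>, so its chosen
  representative has the same class as \<open>\<phi>\<close>.\<close>

lemma inv_cls: "\<Gamma> \<turnstile> inv cls (cls \<phi>) \<^bold>\<rightarrow> \<phi>" "\<Gamma> \<turnstile> \<phi> \<^bold>\<rightarrow> inv cls (cls \<phi>)"
  using cls_eq_iff[of "inv cls (cls \<phi>)" \<phi>] by (simp_all add: f_inv_into_f)

text \<open>Well-definedness: provable equivalence is a congruence for every connective, so the
  chosen representatives may be replaced by the given formulas.\<close>

lemma LT_simps:
  "carrier LT = range cls"
  "cls \<phi> \<sqinter>\<^bsub>LT\<^esub> cls \<psi> = cls (\<phi> \<^bold>\<and> \<psi>)"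
  "cls \<phi> \<squnion>\<^bsub>LT\<^esub> cls \<psi> = cls (\<phi> \<^bold>\<or> \<psi>)"
  "cls \<phi> \<rightarrow>\<^bsub>LT\<^esub> cls \<psi> = cls (\<phi> \<^bold>\<rightarrow> \<psi>)"
  "\<zero>\<^bsub>LT\<^esub> = cls \<^bold>\<bottom>"
  "\<one>\<^bsub>LT\<^esub> = cls \<^bold>\<top>"
  "\<g>\<^bsub>LT\<^esub> (cls \<phi>) = cls (NegG \<phi>)"
  "\<h>\<^bsub>LT\<^esub> (cls \<phi>) = cls (NegH \<phi>)"
  "\<f>\<^bsub>LT\<^esub> (cls \<phi>) = cls (NegF \<phi>)"
  "\<p>\<^bsub>LT\<^esub> (cls \<phi>) = cls (NegP \<phi>)"
  by (simp_all add: LT_def cls_eq_iff inv_cls imp_and and_imp1 and_imp2 or_imp imp_or1 imp_or2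
      imp_mono NegG_antimono NegH_antimono NegF_antimono NegP_antimono)

lemma LT_le: "cls \<phi> \<sqsubseteq>\<^bsub>LT\<^esub> cls \<psi> \<longleftrightarrow> \<Gamma> \<turnstile> \<phi> \<^bold>\<rightarrow> \<psi>"
  unfolding le_def LT_simps cls_eq_iff
  by (meson and_imp1 and_imp2 imp_and imp_refl imp_trans)

lemma LT_heyting: "heyting_algebra LT"
  by (unfold_locales, auto simp: LT_simps LT_le cls_eq_iff bot_imp imp_top rangeI)
    \<comment> \<open>The carrier laws are now derivability claims: residuation is
      \<open>imp_residuation\<close>, and the lattice laws follow from
      \<open>lattice_rules\<close>.\<close>
    (erule iffD1[OF imp_residuation] | erule iffD2[OF imp_residuation] | blast intro: lattice_rules)+

lemma LT_tense: "tense_H_algebra LT"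
proof -
  interpret heyting_algebra LT
    by (rule LT_heyting)
  have one: "\<Gamma> \<turnstile> NegG \<^bold>\<top> \<^bold>\<rightarrow> \<^bold>\<bottom>" "\<Gamma> \<turnstile> NegH \<^bold>\<top> \<^bold>\<rightarrow> \<^bold>\<bottom>"
    by (simp_all add: IGN.GH_up IGN.GH_down imp_top)
  have zero: "\<Gamma> \<turnstile> \<^bold>\<top> \<^bold>\<rightarrow> NegF \<^bold>\<bottom>" "\<Gamma> \<turnstile> \<^bold>\<top> \<^bold>\<rightarrow> NegP \<^bold>\<bottom>"
    by (simp_all add: IGN.FP_up IGN.FP_down bot_imp)
  show ?thesis
    by (unfold_locales, auto simp: LT_simps LT_le cls_eq_iff one zero bot_imp imp_top rangeI
        NegG_and NegH_and NegF_or NegP_or gh_imp hg_imp imp_pf imp_fp)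
      \<comment> \<open>What remains are the antitone halves of the De Morgan identities and the
        four inequalities that are axioms.\<close>
      (blast intro: lattice_rules NegG_antimono NegH_antimono NegF_antimono NegP_antimono
        IGN.galois galois_axioms.intros)+
qed

lemma LT_eval: "eval LT (\<lambda>v. cls (Var v)) \<phi> = cls \<phi>"
  by (induction \<phi>) (simp_all add: LT_simps)

text \<open>Under the canonical assignment a formula evaluates to its own class, and being
  equivalent to truth is the same as being derivable.\<close>

lemma LT_eval_eq_one_iff: "eval LT (\<lambda>v. cls (Var v)) \<phi> = \<one>\<^bsub>LT\<^esub> \<longleftrightarrow> \<Gamma> \<turnstile> \<phi>"
  unfolding LT_eval LT_simps cls_eq_iff
  by (meson IGN.MP IGN.ipl imp_K imp_top ipl_axioms.TopI)

end

section \<open>Realising the quotient inside an infinite type\<close>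

instance fm :: (countable) countable
  by countable_datatype

lemma ex_lindenbaum:
  fixes \<Gamma> :: "'v::countable fm set"
  assumes "infinite (UNIV :: 'a set)"
  shows "\<exists>cls :: 'v fm \<Rightarrow> 'a. lindenbaum \<Gamma> cls"
proof -
  obtain e :: "nat \<Rightarrow> 'a" where e: "inj e"
    using assms infinite_countable_subset by blast
  define eqv where "eqv \<phi> = {\<psi>. \<Gamma> \<turnstile> \<phi> \<^bold>\<rightarrow> \<psi> \<and> \<Gamma> \<turnstile> \<psi> \<^bold>\<rightarrow> \<phi>}" for \<phi>
  \<comment> \<open>Choosing from the set \<open>eqv \<phi>\<close> rather than from
    \<open>\<phi>\<close> itself gives equivalent formulas the same name; \<open>to_nat\<close> and
    \<open>e\<close> are injective, so names separate inequivalent formulas.\<close>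
  define cls where "cls \<phi> = e (to_nat (SOME \<psi>. \<psi> \<in> eqv \<phi>))" for \<phi>
  have self: "\<phi> \<in> eqv \<phi>" for \<phi>
    by (simp add: eqv_def imp_refl)
  have eqv: "eqv \<phi> = eqv \<psi> \<longleftrightarrow> \<psi> \<in> eqv \<phi>" for \<phi> \<psi>
    using self unfolding eqv_def by (blast intro: imp_trans)
  have "cls \<phi> = cls \<psi> \<longleftrightarrow> \<psi> \<in> eqv \<phi>" for \<phi> \<psi>
  proof
    assume "cls \<phi> = cls \<psi>"
    then have "(SOME \<chi>. \<chi> \<in> eqv \<phi>) = (SOME \<chi>. \<chi> \<in> eqv \<psi>)"
      using e by (simp add: cls_def inj_eq)
    \<comment> \<open>The common chosen formula belongs to both classes, which therefore
      coincide.\<close>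
    then have "eqv \<phi> = eqv \<psi>"
      by (metis eqv self someI)
    then show "\<psi> \<in> eqv \<phi>"
      by (simp add: eqv)
  next
    assume "\<psi> \<in> eqv \<phi>"
    then show "cls \<phi> = cls \<psi>"
      by (simp add: cls_def flip: eqv)
  qed
  then have "lindenbaum \<Gamma> cls"
    by (simp add: lindenbaum_def eqv_def)
  then show ?thesis
    by blast
qed

section \<open>Algebraizability from soundness and the Lindenbaum-Tarski algebra\<close>

theorem theorem3p6:
  fixes \<Gamma> :: "'v::countable fm set" and \<phi> \<psi> :: "'v fm"
  assumes "infinite (UNIV :: 'a set)"
  shows "(\<Gamma> \<turnstile> \<phi> \<longleftrightarrow> entails_all (HGN :: 'a tense_alg set) (tau_set \<Gamma>) (tau \<phi>)) \<and>
    entails_all (HGN :: 'a tense_alg set) {\<phi> \<^bold>\<approx> \<psi>} (tau_set (rho (\<phi> \<^bold>\<approx> \<psi>))) \<and>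
    entails_all (HGN :: 'a tense_alg set) (tau_set (rho (\<phi> \<^bold>\<approx> \<psi>))) {\<phi> \<^bold>\<approx> \<psi>}"
proof (intro conjI)
  \<comment> \<open>Both entailments between an equation and its translation hold assignment by
    assignment: the two implications give the two inequalities, and antisymmetry gives
    equality.\<close>
  have sat_iff: "sat A m (\<alpha> \<^bold>\<approx> \<beta>) \<longleftrightarrow> (\<forall>d\<in>tau_set (rho (\<alpha> \<^bold>\<approx> \<beta>)). sat A m d)"
    if "A \<in> HGN" "\<forall>v. m v \<in> carrier A" for A :: "'a tense_alg" and m and \<alpha> \<beta> :: "'v fm"
  proof -
    interpret tense_H_algebra A
      using that(1) by (simp add: HGN_def)
    show ?thesis
      using eval_closed[OF that(2)]
      by (auto simp: sat_def tau_set_def tau_def rho_def impl_eq_one_iff le_refl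
          intro: le_antisym)
  qed
  show "entails_all (HGN :: 'a tense_alg set) {\<phi> \<^bold>\<approx> \<psi>} (tau_set (rho (\<phi> \<^bold>\<approx> \<psi>)))"
    and "entails_all (HGN :: 'a tense_alg set) (tau_set (rho (\<phi> \<^bold>\<approx> \<psi>))) {\<phi> \<^bold>\<approx> \<psi>}"
    using sat_iff by (auto simp: entails_all_def entails_def)
  show "\<Gamma> \<turnstile> \<phi> \<longleftrightarrow> entails_all (HGN :: 'a tense_alg set) (tau_set \<Gamma>) (tau \<phi>)"
  proof
    assume "\<Gamma> \<turnstile> \<phi>"
    then show "entails_all (HGN :: 'a tense_alg set) (tau_set \<Gamma>) (tau \<phi>)"
      by (auto simp: entails_all_def entails_def HGN_def tau_set_def tau_def sat_def
          intro: tense_H_algebra.IGN_sound)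
  next
    assume ent: "entails_all (HGN :: 'a tense_alg set) (tau_set \<Gamma>) (tau \<phi>)"
    obtain cls :: "'v fm \<Rightarrow> 'a" where "lindenbaum \<Gamma> cls"
      using ex_lindenbaum[OF assms] by blast
    then interpret lindenbaum \<Gamma> cls .
    \<comment> \<open>The canonical assignment sends every premise to the unit of \<open>LT\<close>,
      so the assumed entailment does the same for \<open>\<phi>\<close>.\<close>
    let ?m = "\<lambda>v. cls (Var v)"
    have "LT \<in> HGN" "\<forall>v. ?m v \<in> carrier LT"
      by (simp_all add: HGN_def LT_tense LT_simps)
    moreover have "\<forall>d\<in>tau_set \<Gamma>. sat LT ?m d"
      by (simp add: tau_set_def tau_def sat_def LT_eval_eq_one_iff IGN.premise)
    ultimately have "sat LT ?m (\<phi> \<^bold>\<approx> \<^bold>\<top>)"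
      using ent by (simp add: entails_all_def entails_def tau_def)
    then show "\<Gamma> \<turnstile> \<phi>"
      by (simp add: sat_def LT_eval_eq_one_iff)
  qed
qed

end
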